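(* Let $K$ be a field and let $\mathfrak{p}$ and $\mathfrak{q}$ be monomial prime ideals in $R=K[x_1,\dots,x_n]$ with $\mathfrak{q}\subseteq \mathfrak{p}$. Then $\mathfrak{q}$ is a demotion of $\mathfrak{p}$.
   Context: For ideals $J\subseteq I$ in a commutative Noetherian ring $R$, $J$ is a demotion of $I$ if $I^rJ^s=I^{r+s}\cap J^s$ for all integers $r,s\geq 0$ (with $I^0=J^0=R$). A monomial prime ideal is a prime ideal generated by a subset of the variables. *)

theory Defs
  imports
    "HOL-Algebra.Algebra"
    "HOL-Algebra.Algebraic_Closure_Type"
    "HOL-Library.Poly_Mapping"
begin

text \<open>
  Polynomials are finitely supported maps from monomials to coefficients, and a monomial is a
  finitely supported map from variable indices to exponents. The type has variables
  \<open>x\<^sub>i\<close> for every natural number \<open>i\<close>; the carrier below cuts it down to the variables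
  \<open>x\<^sub>1, \<dots>, x\<^sub>n\<close>.
\<close>

type_synonym 'k mpoly = "(nat \<Rightarrow>\<^sub>0 nat) \<Rightarrow>\<^sub>0 'k"

definition mvar :: "nat \<Rightarrow> 'k::field mpoly"
  where "mvar i = Poly_Mapping.single (Poly_Mapping.single i 1) 1"

definition mpoly_carrier :: "nat \<Rightarrow> 'k::field mpoly set"
  where "mpoly_carrier n =
    {f. \<forall>m \<in> Poly_Mapping.keys f. Poly_Mapping.keys m \<subseteq> {1..n}}"

definition mpoly_ring :: "nat \<Rightarrow> 'k::field mpoly ring"
  where "mpoly_ring n = ring_of_type_algebra \<lparr>carrier := mpoly_carrier n\<rparr>"

definition monomial_prime_ideal :: "nat \<Rightarrow> 'k::field mpoly set \<Rightarrow> bool"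
  where "monomial_prime_ideal n P \<longleftrightarrow>
    primeideal P (mpoly_ring n) \<and>
    (\<exists>A \<subseteq> {1..n}. P = genideal (mpoly_ring n) (mvar ` A))"

text \<open>
  \<open>ideals_set R\<close> is the monoid of ideals of \<open>R\<close> under the ideal product, with unit
  \<open>carrier R\<close>. So \<open>I [^] r\<close> in it is the usual power of an ideal, and
  \<open>I [^] 0 = carrier R\<close>. The notion is meant for commutative Noetherian \<open>R\<close>; the definition
  itself does not use the Noetherian property.
\<close>

definition demotion :: "('a, 'b) ring_scheme \<Rightarrow> 'a set \<Rightarrow> 'a set \<Rightarrow> bool"
  where "demotion R J I \<longleftrightarrow>
    ideal J R \<and> ideal I R \<and> J \<subseteq> I \<and>
    (\<forall>(r::nat) (s::nat).
      (I [^]\<^bsub>ideals_set R\<^esub> r) \<cdot>\<^bsub>R\<^esub> (J [^]\<^bsub>ideals_set R\<^esub> s) =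
      (I [^]\<^bsub>ideals_set R\<^esub> (r + s)) \<inter> (J [^]\<^bsub>ideals_set R\<^esub> s))"

lemma mpoly_carrier_subcring:
  "subcring (mpoly_carrier n) (ring_of_type_algebra :: 'k::field mpoly ring)"
proof -
  interpret R: cring "ring_of_type_algebra :: 'k mpoly ring"
    by (rule cring_from_type_algebra)
  have minus: "\<ominus>\<^bsub>ring_of_type_algebra\<^esub> f = - f" for f :: "'k mpoly"
    by (rule R.minus_equality) (simp_all add: ring_of_type_algebra_def)
  have mult: "f * g \<in> mpoly_carrier n" if "f \<in> mpoly_carrier n" "g \<in> mpoly_carrier n"
    for f g :: "'k mpoly"
  proof -
    have "Poly_Mapping.keys m \<subseteq> {1..n}" if m: "m \<in> Poly_Mapping.keys (f * g)" for m
    proof -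
      obtain a b where "m = a + b" "a \<in> Poly_Mapping.keys f" "b \<in> Poly_Mapping.keys g"
        using m keys_mult[of f g] by blast
      with \<open>f \<in> _\<close> \<open>g \<in> _\<close> show ?thesis
        using Poly_Mapping.keys_add[of a b] unfolding mpoly_carrier_def by blast
    qed
    then show ?thesis by (simp add: mpoly_carrier_def)
  qed
  have add: "f + g \<in> mpoly_carrier n" if "f \<in> mpoly_carrier n" "g \<in> mpoly_carrier n"
    for f g :: "'k mpoly"
    using that Poly_Mapping.keys_add[of f g] unfolding mpoly_carrier_def by blast
  show ?thesis
    by (intro R.subcringI' R.subringI)
       (auto simp: minus, auto simp: ring_of_type_algebra_def mult add,
        auto simp: mpoly_carrier_def)
qed

lemma mpoly_ring_domain: "domain (mpoly_ring n :: 'k::field mpoly ring)"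
proof -
  interpret R: cring "ring_of_type_algebra :: 'k mpoly ring"
    by (rule cring_from_type_algebra)
  have "cring (mpoly_ring n :: 'k mpoly ring)"
    using mpoly_carrier_subcring[of n, where 'k = 'k]
      R.subcring_iff[of "mpoly_carrier n"]
    by (simp add: mpoly_ring_def ring_of_type_algebra_def)
  then show ?thesis
    by (rule domain.intro)
       (unfold_locales, auto simp: mpoly_ring_def ring_of_type_algebra_def)
qed

end

theory Submission
  imports Defs
begin

text \<open>
  For a set \<open>A\<close> of variables, let the \<open>A\<close>-degree of a monomial be the sum of its exponents over
  \<open>A\<close>. The proof rests on a description of the powers of \<open>(A)\<close>, the ideal that the variables in
  \<open>A\<close> generate: \<open>(A)\<^sup>r\<close> consists of the polynomials all of whose monomials have \<open>A\<close>-degree at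
  least \<open>r\<close>. Membership in each ideal of the theorem can thus be tested on one monomial at a time.

  Let \<open>\<pp> = (A)\<close> and \<open>\<qq> = (B)\<close>; then \<open>\<qq> \<subseteq> \<pp>\<close> forces \<open>B \<subseteq> A\<close>, since a
  variable in \<open>(A)\<close> has positive \<open>A\<close>-degree. A monomial in
  \<open>\<pp>\<^bsup>r+s\<^esup> \<inter> \<qq>\<^sup>s\<close> has a divisor \<open>v\<close> in the variables of \<open>B\<close> alone with \<open>B\<close>-degree exactly
  \<open>s\<close>. Its \<open>A\<close>-degree is then also exactly \<open>s\<close>, so the cofactor keeps \<open>A\<close>-degree at least \<open>r\<close>:
  the monomial lies in \<open>\<pp>\<^sup>r\<qq>\<^sup>s\<close>. Conversely, the \<open>A\<close>-degree dominates the \<open>B\<close>-degree,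
  so a product of a monomial of \<open>A\<close>-degree at least \<open>r\<close> with one of \<open>B\<close>-degree at least \<open>s\<close> has
  \<open>A\<close>-degree at least \<open>r + s\<close>; it lies in \<open>\<qq>\<^sup>s\<close> because that is an ideal.

  This computation is carried out in \<open>ideal_prod_degree_ideal\<close> for the ideals defined by the degree
  conditions. Its case \<open>A = B\<close>, \<open>s = 1\<close> is the induction step that identifies them with the powers
  of \<open>(A)\<close>, so the same lemma yields both the description of the powers and the theorem.
\<close>

section \<open>Degree of a monomial in a set of variables\<close>

definition degree_in :: "nat set \<Rightarrow> (nat \<Rightarrow>\<^sub>0 nat) \<Rightarrow> nat"
  where "degree_in A m = (\<Sum>i\<in>A. Poly_Mapping.lookup m i)"

lemma degree_in_add: "degree_in A (u + v) = degree_in A u + degree_in A v"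
  by (simp add: degree_in_def lookup_add sum.distrib)

lemma degree_in_mono: "finite A \<Longrightarrow> B \<subseteq> A \<Longrightarrow> degree_in B m \<le> degree_in A m"
  unfolding degree_in_def by (rule sum_mono2) auto

lemma degree_in_eq_if_keys_subset:
  assumes "finite A" "B \<subseteq> A" "Poly_Mapping.keys m \<subseteq> B"
  shows "degree_in A m = degree_in B m"
  unfolding degree_in_def using assms
  by (intro sum.mono_neutral_right) (auto simp: in_keys_iff)

lemma degree_in_single:
  assumes "finite A"
  shows "degree_in A (Poly_Mapping.single i 1) = (if i \<in> A then 1 else 0)"
  using assms by (simp add: degree_in_def lookup_single when_def sum.delta)

lemma split_off_single:
  fixes m :: "nat \<Rightarrow>\<^sub>0 nat"
  assumes "i \<in> Poly_Mapping.keys m"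
  shows "Poly_Mapping.single i 1 + (m - Poly_Mapping.single i 1) = m"
  using assms
  by (intro poly_mapping_eqI)
     (auto simp: lookup_add lookup_minus lookup_single when_def in_keys_iff)

text \<open>
  Variables of \<open>B\<close> can be moved one at a time from the cofactor to the divisor as long as the
  cofactor still contains one, and it does until the divisor has used up the \<open>B\<close>-degree of \<open>m\<close>.
\<close>

lemma monomial_factor_of_degree:
  assumes "s \<le> degree_in B m"
  shows "\<exists>u v. m = u + v \<and> Poly_Mapping.keys v \<subseteq> B \<and> degree_in B v = s"
  using assms
proof (induction s)
  case 0
  show ?case
    by (rule exI[of _ m], rule exI[of _ 0]) (simp add: degree_in_def)
next
  case (Suc s)
  then obtain u v where uv: "m = u + v" "Poly_Mapping.keys v \<subseteq> B" "degree_in B v = s"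
    by auto
  with Suc.prems have pos: "degree_in B u \<noteq> 0"
    by (simp add: degree_in_add)
  then have fin: "finite B"
    by (metis degree_in_def sum.infinite)
  from pos obtain i where i: "i \<in> B" "i \<in> Poly_Mapping.keys u"
    unfolding degree_in_def by (metis in_keys_iff sum.neutral)
  let ?x = "Poly_Mapping.single i (1::nat)"
  have "m = (u - ?x) + (?x + v)"
    using split_off_single[OF i(2)] uv(1) by (metis add.assoc add.commute)
  moreover have "Poly_Mapping.keys (?x + v) \<subseteq> B"
    using Poly_Mapping.keys_add[of ?x v] i uv(2) by auto
  moreover have "degree_in B (?x + v) = Suc s"
    using degree_in_single[OF fin, of i] i uv(3) by (simp add: degree_in_add)
  ultimately show ?case by blast
qed

lemma keys_summand_subset:
  fixes u v :: "nat \<Rightarrow>\<^sub>0 nat"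
  shows "Poly_Mapping.keys u \<subseteq> Poly_Mapping.keys (u + v)"
    and "Poly_Mapping.keys v \<subseteq> Poly_Mapping.keys (u + v)"
  by (auto simp: in_keys_iff lookup_add)

section \<open>Ideals defined by degree conditions\<close>

definition degree_ideal :: "nat \<Rightarrow> nat set \<Rightarrow> nat \<Rightarrow> 'k::field mpoly set"
  where "degree_ideal n A r =
    {f \<in> mpoly_carrier n. \<forall>m \<in> Poly_Mapping.keys f. r \<le> degree_in A m}"

lemma mpoly_ring_simps [simp]:
  "carrier (mpoly_ring n) = mpoly_carrier n"
  "f \<otimes>\<^bsub>mpoly_ring n\<^esub> g = f * g"
  "f \<oplus>\<^bsub>mpoly_ring n\<^esub> g = f + g"
  "\<zero>\<^bsub>mpoly_ring n\<^esub> = 0"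
  "\<one>\<^bsub>mpoly_ring n\<^esub> = 1"
  by (simp_all add: mpoly_ring_def ring_of_type_algebra_def)

lemma mpoly_ring_cring: "cring (mpoly_ring n :: 'k::field mpoly ring)"
  using mpoly_ring_domain by (rule domain.axioms)

text \<open>
  A polynomial is the sum of its terms, so an additively closed set that contains the terms
  contains the polynomial. This reduces membership in an ideal to monomials.
\<close>

lemma mem_if_terms_mem:
  fixes f :: "'a \<Rightarrow>\<^sub>0 'b::comm_monoid_add"
  assumes zero: "0 \<in> S"
    and add: "\<And>g h. g \<in> S \<Longrightarrow> h \<in> S \<Longrightarrow> g + h \<in> S"
    and terms: "\<And>m. m \<in> Poly_Mapping.keys f \<Longrightarrow>
      Poly_Mapping.single m (Poly_Mapping.lookup f m) \<in> S"
  shows "f \<in> S"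
proof -
  have sum_closed: "sum h M \<in> S" if "finite M" "\<And>x. x \<in> M \<Longrightarrow> h x \<in> S"
    for h :: "'a \<Rightarrow> 'a \<Rightarrow>\<^sub>0 'b" and M
    using that by (induction M) (auto intro: zero add)
  have "f = (\<Sum>m\<in>Poly_Mapping.keys f. Poly_Mapping.single m (Poly_Mapping.lookup f m))"
    by (rule poly_mapping_eqI)
       (auto simp: lookup_sum lookup_single when_def sum.delta in_keys_iff)
  also have "\<dots> \<in> S"
    by (rule sum_closed) (auto intro: terms)
  finally show ?thesis .
qed

lemma degree_ideal_zero: "0 \<in> degree_ideal n A r"
  by (simp add: degree_ideal_def mpoly_carrier_def)

lemma degree_ideal_add:
  assumes "f \<in> degree_ideal n A r" "g \<in> degree_ideal n A r"
  shows "f + g \<in> degree_ideal n A r"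
  using assms Poly_Mapping.keys_add[of f g]
  unfolding degree_ideal_def mpoly_carrier_def by blast

lemma single_in_degree_ideal:
  assumes "Poly_Mapping.keys m \<subseteq> {1..n}" "r \<le> degree_in A m"
  shows "Poly_Mapping.single m c \<in> degree_ideal n A r"
  using assms by (simp add: degree_ideal_def mpoly_carrier_def)

lemma degree_ideal_0: "degree_ideal n A 0 = mpoly_carrier n"
  by (simp add: degree_ideal_def)

lemma degree_ideal_mult:
  fixes f g :: "'k::field mpoly"
  assumes f: "f \<in> degree_ideal n A r" and g: "g \<in> degree_ideal n A s"
  shows "f * g \<in> degree_ideal n A (r + s)"
proof -
  interpret cring "mpoly_ring n :: 'k mpoly ring"
    by (rule mpoly_ring_cring)
  have "f * g \<in> mpoly_carrier n"
    using f g m_closed[of f g] by (simp add: degree_ideal_def)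
  moreover have "r + s \<le> degree_in A m" if m: "m \<in> Poly_Mapping.keys (f * g)" for m
  proof -
    obtain a b where "m = a + b" "a \<in> Poly_Mapping.keys f" "b \<in> Poly_Mapping.keys g"
      using m keys_mult[of f g] by blast
    with f g show ?thesis
      by (simp add: degree_ideal_def degree_in_add add_mono)
  qed
  ultimately show ?thesis by (simp add: degree_ideal_def)
qed

lemma ideal_degree_ideal: "ideal (degree_ideal n A r :: 'k::field mpoly set) (mpoly_ring n)"
proof -
  interpret cring "mpoly_ring n :: 'k mpoly ring"
    by (rule mpoly_ring_cring)
  have mult: "f * g \<in> degree_ideal n A r"
    if "f \<in> degree_ideal n A r" "g \<in> mpoly_carrier n" for f g :: "'k mpoly"
    using degree_ideal_mult[of f n A r g 0] that by (simp add: degree_ideal_0)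
  have uminus: "- f \<in> degree_ideal n A r" if "f \<in> degree_ideal n A r" for f :: "'k mpoly"
    using that by (simp add: degree_ideal_def mpoly_carrier_def)
  have carrier: "degree_ideal n A r \<subseteq> (mpoly_carrier n :: 'k mpoly set)"
    by (auto simp: degree_ideal_def)
  have a_inv: "\<ominus>\<^bsub>mpoly_ring n\<^esub> f = - f" if "f \<in> degree_ideal n A r" for f :: "'k mpoly"
    by (rule minus_equality) (use that uminus carrier in auto)
  show ?thesis
  proof (rule idealI)
    show "ring (mpoly_ring n :: 'k mpoly ring)" by (rule ring_axioms)
    show "subgroup (degree_ideal n A r :: 'k mpoly set) (add_monoid (mpoly_ring n))"
      by (rule add.subgroupI)
         (use carrier degree_ideal_zero[of n A r] degree_ideal_add uminus a_inv
           in \<open>auto simp flip: a_inv_def\<close>)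
  qed (auto simp: mult mult.commute)
qed

section \<open>Products and powers of ideals generated by variables\<close>

lemma genideal_mvar:
  assumes A: "A \<subseteq> {1..n}"
  shows "genideal (mpoly_ring n) (mvar ` A) = (degree_ideal n A 1 :: 'k::field mpoly set)"
proof
  interpret cring "mpoly_ring n :: 'k mpoly ring"
    by (rule mpoly_ring_cring)
  have fin: "finite A"
    using A finite_subset by blast
  have "mvar ` A \<subseteq> (degree_ideal n A 1 :: 'k mpoly set)"
    using A degree_in_single[OF fin]
    by (auto simp: mvar_def intro!: single_in_degree_ideal)
  then show "genideal (mpoly_ring n) (mvar ` A) \<subseteq> (degree_ideal n A 1 :: 'k mpoly set)"
    by (rule genideal_minimal[OF ideal_degree_ideal])
  have vars: "mvar ` A \<subseteq> carrier (mpoly_ring n :: 'k mpoly ring)"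
    using A by (auto simp: mvar_def mpoly_carrier_def)
  let ?I = "genideal (mpoly_ring n) (mvar ` A) :: 'k mpoly set"
  interpret I: ideal ?I "mpoly_ring n"
    by (rule genideal_ideal[OF vars])
  show "degree_ideal n A 1 \<subseteq> ?I"
  proof
    fix f :: "'k mpoly"
    assume f: "f \<in> degree_ideal n A 1"
    show "f \<in> ?I"
    proof (rule mem_if_terms_mem)
      show "0 \<in> ?I"
        using I.zero_closed by simp
      show "g + h \<in> ?I" if "g \<in> ?I" "h \<in> ?I" for g h
        using I.a_closed[OF that] by simp
      fix m
      assume m: "m \<in> Poly_Mapping.keys f"
      let ?c = "Poly_Mapping.lookup f m"
      from f m have "degree_in A m \<noteq> 0" and m_keys: "Poly_Mapping.keys m \<subseteq> {1..n}"
        by (auto simp: degree_ideal_def mpoly_carrier_def)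
      then obtain i where i: "i \<in> A" "i \<in> Poly_Mapping.keys m"
        unfolding degree_in_def by (metis in_keys_iff sum.neutral)
      let ?x = "Poly_Mapping.single i (1::nat)"
      have split: "?x + (m - ?x) = m"
        by (rule split_off_single[OF i(2)])
      then have "Poly_Mapping.keys (m - ?x) \<subseteq> {1..n}"
        using keys_summand_subset(2)[of "m - ?x" ?x] m_keys by simp
      then have "Poly_Mapping.single (m - ?x) ?c \<in> mpoly_carrier n"
        by (simp add: mpoly_carrier_def)
      moreover have "mvar i \<in> ?I"
        using genideal_self[OF vars] i(1) by blast
      ultimately have "mvar i * Poly_Mapping.single (m - ?x) ?c \<in> ?I"
        using I.I_r_closed[of "mvar i"] by simp
      then show "Poly_Mapping.single m ?c \<in> ?I"
        by (simp only: mvar_def mult_single split mult_1)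
    qed
  qed
qed

text \<open>
  For the inclusion from right to left, each term of \<open>f\<close> is written as a product \<open>c u \<cdot> v\<close> where
  \<open>v\<close> involves only variables of \<open>B\<close> and has \<open>B\<close>-degree exactly \<open>s\<close>. As \<open>v\<close> uses up
  just \<open>s\<close> of the \<open>A\<close>-degree \<open>\<ge> r + s\<close>, there remains at least \<open>r\<close> for \<open>u\<close>.
\<close>

lemma ideal_prod_degree_ideal:
  assumes BA: "B \<subseteq> A" and fin: "finite A"
  shows "degree_ideal n A r \<cdot>\<^bsub>mpoly_ring n\<^esub> degree_ideal n B s =
    (degree_ideal n A (r + s) \<inter> degree_ideal n B s :: 'k::field mpoly set)"
    (is "?P = ?D")
proof
  interpret cring "mpoly_ring n :: 'k mpoly ring"
    by (rule mpoly_ring_cring)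
  have le: "degree_ideal n B s \<subseteq> (degree_ideal n A s :: 'k mpoly set)"
    using degree_in_mono[OF fin BA] le_trans unfolding degree_ideal_def by blast
  have "f \<in> degree_ideal n A (r + s)" if "f \<in> ?P" for f
    using that
    by (induction f rule: ideal_prod.induct)
       (use le in \<open>auto simp: degree_ideal_mult degree_ideal_add\<close>)
  then have "?P \<subseteq> degree_ideal n A (r + s)"
    by blast
  then show "?P \<subseteq> ?D"
    using ideal_prod_inter[OF ideal_degree_ideal ideal_degree_ideal] by blast
  show "?D \<subseteq> ?P"
  proof
    fix f :: "'k mpoly"
    assume f: "f \<in> ?D"
    show "f \<in> ?P"
    proof (rule mem_if_terms_mem)
      show "0 \<in> ?P"
        using ideal_prod.prod[OF degree_ideal_zero degree_ideal_zero, of "mpoly_ring n" n A r n B s]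
        by simp
      show "g + h \<in> ?P" if "g \<in> ?P" "h \<in> ?P" for g h
        using ideal_prod.sum[OF that] by simp
      fix m
      assume m: "m \<in> Poly_Mapping.keys f"
      let ?c = "Poly_Mapping.lookup f m"
      from f m have degA: "r + s \<le> degree_in A m" and degB: "s \<le> degree_in B m"
        and keys: "Poly_Mapping.keys m \<subseteq> {1..n}"
        by (auto simp: degree_ideal_def mpoly_carrier_def)
      obtain u v where uv: "m = u + v" "Poly_Mapping.keys v \<subseteq> B" "degree_in B v = s"
        using monomial_factor_of_degree[OF degB] by blast
      have "degree_in A v = s"
        using degree_in_eq_if_keys_subset[OF fin BA uv(2)] uv(3) by simp
      with degA uv(1) have "r \<le> degree_in A u"
        by (simp add: degree_in_add)
      then have "Poly_Mapping.single u ?c \<in> degree_ideal n A r"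
        using keys keys_summand_subset(1)[of u v] uv(1) by (intro single_in_degree_ideal) auto
      moreover have "Poly_Mapping.single v 1 \<in> (degree_ideal n B s :: 'k mpoly set)"
        using keys keys_summand_subset(2)[of v u] uv(1,3) by (intro single_in_degree_ideal) auto
      ultimately have "Poly_Mapping.single u ?c * Poly_Mapping.single v 1 \<in> ?P"
        using ideal_prod.prod[of "Poly_Mapping.single u ?c" _ _ _ "mpoly_ring n"] by simp
      then show "Poly_Mapping.single m ?c \<in> ?P"
        by (simp add: mult_single uv(1))
    qed
  qed
qed

lemma degree_ideal_antimono:
  "r \<le> s \<Longrightarrow> degree_ideal n A s \<subseteq> (degree_ideal n A r :: 'k::field mpoly set)"
  by (auto simp: degree_ideal_def)

lemma genideal_mvar_power:
  assumes A: "A \<subseteq> {1..n}"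
  shows "genideal (mpoly_ring n) (mvar ` A) [^]\<^bsub>ideals_set (mpoly_ring n)\<^esub> (r::nat) =
    (degree_ideal n A r :: 'k::field mpoly set)"
proof (induction r)
  case 0
  show ?case
    by (simp add: ideals_set_def degree_ideal_0)
next
  case (Suc r)
  have "finite A"
    using A finite_subset by blast
  then have "degree_ideal n A r \<cdot>\<^bsub>mpoly_ring n\<^esub> degree_ideal n A 1 =
      (degree_ideal n A (Suc r) :: 'k mpoly set)"
    using ideal_prod_degree_ideal[of A A n r 1, where 'k = 'k]
      degree_ideal_antimono[of 1 "Suc r" n A, where 'k = 'k]
    by (simp add: Int_absorb2)
  with Suc show ?case
    by (simp add: ideals_set_def genideal_mvar[OF A] nat_pow_def)
qed

theorem proposition4p2:
  fixes n :: nat and p q :: "'k::field mpoly set"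
  assumes "monomial_prime_ideal n p"
    and "monomial_prime_ideal n q"
    and "q \<subseteq> p"
  shows "demotion (mpoly_ring n) q p"
proof -
  interpret cring "mpoly_ring n :: 'k mpoly ring"
    by (rule mpoly_ring_cring)
  obtain A where A: "A \<subseteq> {1..n}" "p = genideal (mpoly_ring n) (mvar ` A)"
    using assms(1) by (auto simp: monomial_prime_ideal_def)
  obtain B where B: "B \<subseteq> {1..n}" "q = genideal (mpoly_ring n) (mvar ` B)"
    using assms(2) by (auto simp: monomial_prime_ideal_def)
  have finA: "finite A"
    using A(1) finite_subset by blast
  have "B \<subseteq> A"
  proof
    fix i
    assume i: "i \<in> B"
    have "mvar ` B \<subseteq> carrier (mpoly_ring n :: 'k mpoly ring)"
      using B(1) by (auto simp: mvar_def mpoly_carrier_def)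
    from genideal_self[OF this] i assms(3) B(2) have "mvar i \<in> p"
      by blast
    then have "(mvar i :: 'k mpoly) \<in> degree_ideal n A 1"
      by (simp add: A(2) genideal_mvar[OF A(1)])
    then show "i \<in> A"
      using degree_in_single[OF finA, of i]
      by (auto simp: degree_ideal_def mvar_def split: if_splits)
  qed
  have "ideal p (mpoly_ring n)" "ideal q (mpoly_ring n)"
    using assms(1,2) by (auto simp: monomial_prime_ideal_def primeideal_def)
  then show ?thesis
    unfolding demotion_def
    using assms(3) ideal_prod_degree_ideal[OF \<open>B \<subseteq> A\<close> finA, where 'k = 'k]
    by (simp add: A(2) B(2) genideal_mvar_power[OF A(1)] genideal_mvar_power[OF B(1)])
qed

end
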